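(* For every $m\ge 1$, the second set-theoretic Yang-Baxter homology group of the cyclic biquandle $C_m$ of order $m$ is torsion-free; hence $H_2^{YB}(C_m)\cong\mathbb{Z}^m$.
   Context: The cyclic biquandle $C_m$ of order $m$ is the set $\mathbb{Z}/m\mathbb{Z}$ with the map $R(a,b)=(b+1,a-1)$. Its set-theoretic Yang-Baxter chain complex: for $n\ge 1$, $C_n^{YB}(C_m)$ is the free abelian group with basis $(C_m)^n$, and $C_n^{YB}(C_m)=0$ for $n\le 0$. The boundary is $\partial_n=\sum_{i=1}^n(-1)^{i-1}(d^l_{i,n}-d^r_{i,n})$ for $n\ge 2$ (and $\partial_n=0$ for $n\le 1$), where on basis elements $$d^l_{i,n}(x_1,\ldots,x_n)=(x_1-1,\ldots,x_{i-1}-1,x_{i+1},\ldots,x_n),$$ $$d^r_{i,n}(x_1,\ldots,x_n)=(x_1,\ldots,x_{i-1},x_{i+1}+1,\ldots,x_n+1).$$ $H_n^{YB}(C_m)$ is the $n$th homology group of this complex of abelian groups. *)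

theory Defs
  imports "HOL-Algebra.Algebra"
begin

text \<open>
  The underlying set of the cyclic biquandle of order \<open>m\<close>: \<open>\<int>/m\<int>\<close> is represented by the least
  non-negative residues, and all arithmetic below is reduced modulo \<open>m\<close>.
\<close>

definition cyc :: "nat \<Rightarrow> int set" where
  "cyc m = {0..<int m}"

definition cyc_R :: "nat \<Rightarrow> int \<times> int \<Rightarrow> int \<times> int" where
  "cyc_R m = (\<lambda>(a, b). ((b + 1) mod int m, (a - 1) mod int m))"

definition cyc_tuples :: "nat \<Rightarrow> nat \<Rightarrow> int list set" where
  "cyc_tuples m n = {xs. length xs = n \<and> set xs \<subseteq> cyc m}"

text \<open>
  The face maps are indexed from \<open>i = 1\<close>, so \<open>take (i - 1) xs\<close> is \<open>(x\<^sub>1, \<dots>, x\<^bsub>i-1\<^esub>)\<close> and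
  \<open>drop i xs\<close> is \<open>(x\<^bsub>i+1\<^esub>, \<dots>, x\<^sub>n)\<close>. The length \<open>n\<close> is read off from the tuple.
\<close>

definition face_l :: "nat \<Rightarrow> nat \<Rightarrow> int list \<Rightarrow> int list" where
  "face_l m i xs = map (\<lambda>x. (x - 1) mod int m) (take (i - 1) xs) @ drop i xs"

definition face_r :: "nat \<Rightarrow> nat \<Rightarrow> int list \<Rightarrow> int list" where
  "face_r m i xs = take (i - 1) xs @ map (\<lambda>x. (x + 1) mod int m) (drop i xs)"

text \<open>
  These are the face maps of the Yang-Baxter complex of \<open>cyc_R\<close>: the left (right) face moves the
  \<open>i\<close>-th entry to the left (right) end by successive applications of \<open>cyc_R\<close> to neighbouring
  entries and then deletes it.
\<close>

definition cyc_R_at :: "nat \<Rightarrow> nat \<Rightarrow> int list \<Rightarrow> int list" where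
  "cyc_R_at m i xs =
     (let (a, b) = cyc_R m (xs ! (i - 1), xs ! i) in take (i - 1) xs @ [a, b] @ drop (i + 1) xs)"

lemma face_l_1: "face_l m 1 xs = tl xs"
  by (simp add: face_l_def drop_Suc)

lemma face_l_Suc:
  assumes "1 \<le> i" "i < length xs"
  shows "face_l m (Suc i) xs = face_l m i (cyc_R_at m i xs)"
proof -
  obtain j where j: "i = Suc j" using assms by (cases i) auto
  show ?thesis using assms
    by (simp add: j face_l_def cyc_R_at_def cyc_R_def take_Suc_conv_app_nth)
qed

lemma face_r_length:
  assumes "xs \<noteq> []"
  shows "face_r m (length xs) xs = butlast xs"
  by (simp add: face_r_def butlast_conv_take)

lemma face_r_Suc:
  assumes "1 \<le> i" "i < length xs"
  shows "face_r m i xs = face_r m (Suc i) (cyc_R_at m i xs)"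
proof -
  obtain j where j: "i = Suc j" using assms by (cases i) auto
  show ?thesis using assms
    by (simp add: j face_r_def cyc_R_at_def cyc_R_def Cons_nth_drop_Suc [symmetric])
qed

definition YB_chain_group :: "nat \<Rightarrow> int \<Rightarrow> (int list \<Rightarrow>\<^sub>0 int) monoid" where
  "YB_chain_group m n = free_Abelian_group (if 1 \<le> n then cyc_tuples m (nat n) else {})"

text \<open>The map \<open>frag_extend\<close> extends a map on basis elements linearly to the free Abelian group.\<close>

definition YB_boundary :: "nat \<Rightarrow> int \<Rightarrow> (int list \<Rightarrow>\<^sub>0 int) \<Rightarrow> (int list \<Rightarrow>\<^sub>0 int)" where
  "YB_boundary m n =
     (if 2 \<le> n
      then frag_extend (\<lambda>xs. \<Sum>i = 1..nat n.
             frag_cmul ((- 1) ^ (i - 1)) (frag_of (face_l m i xs) - frag_of (face_r m i xs)))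
      else (\<lambda>_. 0))"

definition YB_cycle_group :: "nat \<Rightarrow> int \<Rightarrow> (int list \<Rightarrow>\<^sub>0 int) monoid" where
  "YB_cycle_group m n =
     subgroup_generated (YB_chain_group m n)
       (kernel (YB_chain_group m n) (YB_chain_group m (n - 1)) (YB_boundary m n))"

definition YB_homology_group :: "nat \<Rightarrow> int \<Rightarrow> (int list \<Rightarrow>\<^sub>0 int) set monoid" where
  "YB_homology_group m n =
     YB_cycle_group m n Mod (YB_boundary m (n + 1) ` carrier (YB_chain_group m (n + 1)))"

definition torsion_free_group :: "('a, 'b) monoid_scheme \<Rightarrow> bool" where
  "torsion_free_group G \<longleftrightarrow>
     (\<forall>x \<in> carrier G. \<forall>k::nat. 0 < k \<longrightarrow> x [^]\<^bsub>G\<^esub> k = \<one>\<^bsub>G\<^esub> \<longrightarrow> x = \<one>\<^bsub>G\<^esub>)"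

end

theory Submission
  imports Defs
begin

text \<open>
  Write \<open>D a b = (a, b) - (a+1, b+1)\<close>. The boundary of \<open>(x, y, z)\<close> is
  \<open>D y z - D (x-1) z + D (x-1) (y-1)\<close>, and the boundary of \<open>(a, b)\<close> is \<open>h a - h (b+1)\<close> with
  \<open>h a = (a) - (a-1)\<close>. Modulo boundaries every 2-chain is therefore a combination of the \<open>(0, j)\<close>,
  with coefficients its sums along the diagonals \<open>y - x = j\<close>, plus a combination of the \<open>D 0 t\<close>
  whose coefficients sum to 0. If the diagonal sums of a cycle vanish, then the coefficients of
  the \<open>D 0 t\<close> have zero second difference around the cycle, so they vanish. Thus the diagonal sums
  \<open>s\<^sub>j\<close> embed the homology group in \<open>\<int>\<^sup>m\<close>. The image is the lattice of all \<open>s\<close> with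
  \<open>\<Sum>j. (j+1) s\<^sub>j\<close> divisible by \<open>m\<close>, and replacing \<open>s\<^sub>0\<close> by this sum divided by \<open>m\<close> gives
  coordinates that identify it with \<open>\<int>\<^sup>m\<close>.
\<close>

section \<open>Functionals on free abelian groups\<close>

text \<open>The linear functional with values \<open>f\<close> on the basis. As
  \<open>frag_extend\<close> takes values in free abelian groups, the integers are modelled as the
  free group on \<open>()\<close>, and the coefficient of \<open>()\<close> is read off.\<close>

definition frag_pairing :: "('a \<Rightarrow> int) \<Rightarrow> ('a \<Rightarrow>\<^sub>0 int) \<Rightarrow> int" where
  "frag_pairing f z = Poly_Mapping.lookup (frag_extend (\<lambda>x. frag_cmul (f x) (frag_of ())) z) ()"

lemma frag_pairing_of [simp]: "frag_pairing f (frag_of x) = f x"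
  by (simp add: frag_pairing_def)

lemma frag_pairing_0 [simp]: "frag_pairing f 0 = 0"
  by (simp add: frag_pairing_def)

lemma frag_pairing_add: "frag_pairing f (a + b) = frag_pairing f a + frag_pairing f b"
  by (simp add: frag_pairing_def frag_extend_add lookup_add)

lemma frag_pairing_diff: "frag_pairing f (a - b) = frag_pairing f a - frag_pairing f b"
  by (simp add: frag_pairing_def frag_extend_diff lookup_minus)

lemma frag_pairing_cmul: "frag_pairing f (frag_cmul c a) = c * frag_pairing f a"
  by (simp add: frag_pairing_def frag_extend_cmul)

lemma frag_pairing_sum: "frag_pairing f (sum g I) = (\<Sum>i\<in>I. frag_pairing f (g i))"
  by (induction I rule: infinite_finite_induct) (simp_all add: frag_pairing_add)

lemmas frag_pairing_linear =
  frag_pairing_add frag_pairing_diff frag_pairing_cmul frag_pairing_sum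

lemma keys_diff_subset:
  "Poly_Mapping.keys a \<subseteq> S \<Longrightarrow> Poly_Mapping.keys b \<subseteq> S \<Longrightarrow> Poly_Mapping.keys (a - b) \<subseteq> S"
  for a b :: "'a \<Rightarrow>\<^sub>0 int"
  by (rule subset_trans [OF keys_diff]) simp

lemma keys_sum_subset:
  "(\<And>i. i \<in> I \<Longrightarrow> Poly_Mapping.keys (f i) \<subseteq> S) \<Longrightarrow> Poly_Mapping.keys (sum f I) \<subseteq> S"
  for f :: "'b \<Rightarrow> 'a \<Rightarrow>\<^sub>0 int"
  by (rule subset_trans [OF keys_sum]) blast

section \<open>Chains of degree two\<close>

text \<open>Reducing inside this definition and \<open>cyc_pair\<close> lets the arguments be
  arbitrary integers, so that shifted entries such as \<open>a - 1\<close> need no explicit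
  \<open>mod\<close>.\<close>

definition cyc_point :: "nat \<Rightarrow> int \<Rightarrow> int list \<Rightarrow>\<^sub>0 int" where
  "cyc_point m a = frag_of [a mod int m]"

definition cyc_pair :: "nat \<Rightarrow> int \<Rightarrow> int \<Rightarrow> int list \<Rightarrow>\<^sub>0 int" where
  "cyc_pair m a b = frag_of [a mod int m, b mod int m]"

definition diag_step :: "nat \<Rightarrow> int \<Rightarrow> int \<Rightarrow> int list \<Rightarrow>\<^sub>0 int" where
  "diag_step m a b = cyc_pair m a b - cyc_pair m (a + 1) (b + 1)"

definition pair_pairing :: "(int \<Rightarrow> int \<Rightarrow> int) \<Rightarrow> (int list \<Rightarrow>\<^sub>0 int) \<Rightarrow> int" where
  "pair_pairing f = frag_pairing (\<lambda>xs. f (xs ! 0) (xs ! 1))"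

lemma pair_pairing_linear:
  "pair_pairing f (a + b) = pair_pairing f a + pair_pairing f b"
  "pair_pairing f (a - b) = pair_pairing f a - pair_pairing f b"
  "pair_pairing f (frag_cmul c a) = c * pair_pairing f a"
  "pair_pairing f (sum h I) = (\<Sum>i\<in>I. pair_pairing f (h i))"
  by (simp_all add: pair_pairing_def frag_pairing_linear)

lemma pair_pairing_0 [simp]: "pair_pairing f 0 = 0"
  by (simp add: pair_pairing_def)

lemma pair_pairing_pair [simp]:
  "pair_pairing f (cyc_pair m a b) = f (a mod int m) (b mod int m)"
  by (simp add: pair_pairing_def cyc_pair_def)

lemma cyc_pair_cong:
  "a mod int m = a' mod int m \<Longrightarrow> b mod int m = b' mod int m \<Longrightarrow> cyc_pair m a b = cyc_pair m a' b'"
  by (simp add: cyc_pair_def)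

lemma finite_cyc [simp]: "finite (cyc m)"
  by (simp add: cyc_def)

lemma mod_in_cyc [simp]: "m \<ge> 1 \<Longrightarrow> a mod int m \<in> cyc m"
  by (simp add: cyc_def)

lemma mod_cyc: "a \<in> cyc m \<Longrightarrow> a mod int m = a"
  by (simp add: cyc_def)

lemma keys_cyc_pair: "m \<ge> 1 \<Longrightarrow> Poly_Mapping.keys (cyc_pair m a b) \<subseteq> cyc_tuples m 2"
  by (simp add: cyc_pair_def cyc_tuples_def)

lemma length_eq_3_iff: "length xs = 3 \<longleftrightarrow> (\<exists>a b c. xs = [a, b, c])"
  by (auto simp: numeral_3_eq_3 length_Suc_conv)

lemma length_eq_2_iff: "length xs = 2 \<longleftrightarrow> (\<exists>a b. xs = [a, b])"
  by (auto simp: numeral_2_eq_2 length_Suc_conv)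

lemma chain2_induct [consumes 1, case_names zero pair diff]:
  assumes "Poly_Mapping.keys z \<subseteq> cyc_tuples m 2"
    and "P 0"
    and pair: "\<And>a b. a \<in> cyc m \<Longrightarrow> b \<in> cyc m \<Longrightarrow> P (cyc_pair m a b)"
    and "\<And>z w. P z \<Longrightarrow> P w \<Longrightarrow> P (z - w)"
  shows "P z"
  using assms(1)
proof (induction rule: frag_induction)
  case (one xs)
  then obtain a b where "xs = [a, b]" "a \<in> cyc m" "b \<in> cyc m"
    by (auto simp: cyc_tuples_def length_eq_2_iff)
  then show ?case
    using pair [of a b] by (simp add: cyc_pair_def mod_cyc)
qed (use assms in auto)

lemma boundary2_pair:
  "YB_boundary m 2 (cyc_pair m a b) =
     (cyc_point m a - cyc_point m (a - 1)) - (cyc_point m (b + 1) - cyc_point m b)"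
proof -
  have "{1..nat 2} = {1, 2}" by auto
  then show ?thesis
    by (simp add: YB_boundary_def cyc_pair_def cyc_point_def face_l_def face_r_def mod_simps
        take_Suc numeral_2_eq_2)
qed

text \<open>For each index, the right face is the left face with both entries raised by one, so the
  two faces together form one diagonal step.\<close>

lemma boundary3_triple:
  "YB_boundary m 3 (frag_of [a mod int m, b mod int m, c mod int m]) =
     diag_step m b c - diag_step m (a - 1) c + diag_step m (a - 1) (b - 1)"
proof -
  have "{1..nat 3} = {1, 2, 3}" by auto
  then show ?thesis
    by (simp add: YB_boundary_def cyc_pair_def diag_step_def face_l_def face_r_def mod_simps
        take_Suc numeral_2_eq_2 numeral_3_eq_3)
qed

lemma YB_boundary_diff: "YB_boundary m n (z - w) = YB_boundary m n z - YB_boundary m n w"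
  by (simp add: YB_boundary_def frag_extend_diff)

lemma YB_boundary_add: "YB_boundary m n (z + w) = YB_boundary m n z + YB_boundary m n w"
  by (simp add: YB_boundary_def frag_extend_add)

lemma YB_boundary_0 [simp]: "YB_boundary m n 0 = 0"
  by (simp add: YB_boundary_def)

lemma YB_boundary_cmul: "YB_boundary m n (frag_cmul c z) = frag_cmul c (YB_boundary m n z)"
  by (simp add: YB_boundary_def frag_extend_cmul)

lemma YB_boundary_sum: "YB_boundary m n (sum f I) = (\<Sum>i\<in>I. YB_boundary m n (f i))"
  by (induction I rule: infinite_finite_induct) (simp_all add: YB_boundary_add)

lemma carrier_YB_chain_group_iff:
  "n \<ge> 1 \<Longrightarrow> z \<in> carrier (YB_chain_group m n) \<longleftrightarrow> Poly_Mapping.keys z \<subseteq> cyc_tuples m (nat n)"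
  by (simp add: YB_chain_group_def)

section \<open>Cycles\<close>

definition diag_sum :: "nat \<Rightarrow> int \<Rightarrow> (int list \<Rightarrow>\<^sub>0 int) \<Rightarrow> int" where
  "diag_sum m j = pair_pairing (\<lambda>x y. of_bool ((y - x) mod int m = j))"

definition diag_weight :: "nat \<Rightarrow> (int list \<Rightarrow>\<^sub>0 int) \<Rightarrow> int" where
  "diag_weight m = pair_pairing (\<lambda>x y. (y - x) mod int m + 1)"

text \<open>The weighted number of pairs \<open>(t, y)\<close> minus that of pairs
  \<open>(x, t - 1)\<close>. It is a discrete primitive of the boundary, whose coefficients are
  differences of consecutive defects.\<close>

definition cycle_defect :: "nat \<Rightarrow> int \<Rightarrow> (int list \<Rightarrow>\<^sub>0 int) \<Rightarrow> int" where
  "cycle_defect m t = pair_pairing (\<lambda>x y. of_bool (x = t) - of_bool ((y + 1) mod int m = t))"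

lemma mod_shift_iff:
  assumes "t \<in> cyc m"
  shows "(a + c) mod int m = (t + c) mod int m \<longleftrightarrow> a mod int m = t"
proof -
  have "(a + c) mod int m = (t + c) mod int m \<longleftrightarrow> int m dvd ((a + c) - (t + c))"
    by (rule mod_eq_dvd_iff)
  also have "\<dots> \<longleftrightarrow> a mod int m = t mod int m"
    by (simp add: mod_eq_dvd_iff)
  finally show ?thesis
    using assms by (simp add: mod_cyc)
qed

text \<open>By \<open>step\<close> the function is constant around the cycle, so its sum is
  \<open>m\<close> times that constant.\<close>

lemma cyclic_constant_sum_0:
  fixes f :: "int \<Rightarrow> int"
  assumes m: "m \<ge> 1" and step: "\<And>t. t \<in> cyc m \<Longrightarrow> f t = f ((t + 1) mod int m)"
    and sum: "(\<Sum>t\<in>cyc m. f t) = 0" and t: "t \<in> cyc m"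
  shows "f t = 0"
proof -
  have const: "f (int k) = f 0" if "k < m" for k
    using that
  proof (induction k)
    case (Suc k)
    then show ?case
      using step [of "int k"] by (simp add: cyc_def ac_simps)
  qed simp
  have const': "f s = f 0" if "s \<in> cyc m" for s
    using const [of "nat s"] that by (simp add: cyc_def nat_less_iff)
  have "(\<Sum>t\<in>cyc m. f t) = int m * f 0"
    by (simp add: const' cong: sum.cong) (simp add: cyc_def)
  then show ?thesis
    using sum m const' [OF t] by simp
qed

text \<open>In the boundary \<open>(a) - (a-1) - (b+1) + (b)\<close> of a pair, the terms
  \<open>a\<close> and \<open>b+1\<close> give the defect at \<open>t\<close>. The terms
  \<open>a-1\<close> and \<open>b\<close>, shifted by one, give minus the defect at
  \<open>t+1\<close>.\<close>

lemma lookup_boundary2: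
  assumes m: "m \<ge> 1" and z: "Poly_Mapping.keys z \<subseteq> cyc_tuples m 2" and t: "t \<in> cyc m"
  shows "Poly_Mapping.lookup (YB_boundary m 2 z) [t] =
    cycle_defect m t z - cycle_defect m ((t + 1) mod int m) z"
  using z
proof (induction rule: chain2_induct)
  case (pair a b)
  have lookup: "Poly_Mapping.lookup (cyc_point m c) [t] = of_bool (c mod int m = t)" for c
    by (auto simp: cyc_point_def)
  have shift: "((a - 1) mod int m = t) = (a mod int m = (t + 1) mod int m)"
      "(b mod int m = t) = ((b + 1) mod int m = (t + 1) mod int m)"
    using mod_shift_iff [OF t, of "a - 1" 1] mod_shift_iff [OF t, of b 1] by simp_all
  show ?case
    by (simp only: boundary2_pair lookup_minus lookup cycle_defect_def pair_pairing_pair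
        mod_add_left_eq shift)
qed (simp_all add: cycle_defect_def YB_boundary_diff pair_pairing_linear lookup_minus)

text \<open>A pair contributes 1 at the residue \<open>x\<close> and -1 at the residue
  \<open>y + 1\<close>.\<close>

lemma sum_cycle_defect:
  assumes m: "m \<ge> 1" and z: "Poly_Mapping.keys z \<subseteq> cyc_tuples m 2"
  shows "(\<Sum>t\<in>cyc m. cycle_defect m t z) = 0"
  using z
proof (induction rule: chain2_induct)
  case (pair a b)
  then show ?case
    using m by (simp add: cycle_defect_def sum_subtractf of_bool_def mod_simps sum.delta)
qed (simp_all add: cycle_defect_def pair_pairing_linear sum_subtractf)

text \<open>A zero boundary makes the defect constant in \<open>t\<close>, and its total is
  zero.\<close>

lemma cycle_defect_eq_0:
  assumes m: "m \<ge> 1" and z: "Poly_Mapping.keys z \<subseteq> cyc_tuples m 2"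
    and "YB_boundary m 2 z = 0" and "t \<in> cyc m"
  shows "cycle_defect m t z = 0"
proof (rule cyclic_constant_sum_0 [where f = "\<lambda>t. cycle_defect m t z", OF m])
  show "cycle_defect m t z = cycle_defect m ((t + 1) mod int m) z" if "t \<in> cyc m" for t
    using lookup_boundary2 [OF m z that] assms by simp
qed (use sum_cycle_defect [OF m z] assms in auto)

text \<open>
  Summing over a cycle, the terms \<open>y + 1\<close> and \<open>x\<close> of the weights cancel modulo \<open>m\<close>, because each
  residue occurs equally often as a \<open>y + 1\<close> and as an \<open>x\<close>: this is \<open>cycle_defect m t z = 0\<close>.
\<close>
lemma diag_weight_cong_cycle_defect:
  assumes m: "m \<ge> 1" and z: "Poly_Mapping.keys z \<subseteq> cyc_tuples m 2"
  shows "int m dvd diag_weight m z + (\<Sum>t\<in>cyc m. t * cycle_defect m t z)"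
  using z
proof (induction rule: chain2_induct)
  case (pair a b)
  \<comment> \<open>Without the reductions the left side is zero; what remains are the multiples of
    \<open>m\<close> that the reductions remove.\<close>
  have "(b - a) mod int m + 1 + (a mod int m - (b + 1) mod int m) =
      int m * ((b + 1) div int m - (b - a) div int m - a div int m)"
    by (simp add: minus_mult_div_eq_mod [symmetric] algebra_simps)
  moreover have "(\<Sum>t\<in>cyc m. t * cycle_defect m t (cyc_pair m a b)) = a mod int m - (b + 1) mod int m"
    using m by (simp add: cycle_defect_def sum_subtractf right_diff_distrib
        of_bool_def mod_add_left_eq if_distrib [of "\<lambda>x. _ * x"] sum.delta cong: if_cong)
  moreover have "diag_weight m (cyc_pair m a b) = (b - a) mod int m + 1"
    by (simp add: diag_weight_def mod_simps)
  ultimately show ?case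
    by (metis dvd_triv_left)
next
  case (diff z w)
  have "diag_weight m (z - w) + (\<Sum>t\<in>cyc m. t * cycle_defect m t (z - w)) =
    (diag_weight m z + (\<Sum>t\<in>cyc m. t * cycle_defect m t z)) -
    (diag_weight m w + (\<Sum>t\<in>cyc m. t * cycle_defect m t w))"
    by (simp add: diag_weight_def cycle_defect_def pair_pairing_linear sum_subtractf
        right_diff_distrib)
  then show ?case
    using diff by (metis dvd_diff)
qed (simp add: diag_weight_def cycle_defect_def)

lemma cycle_dvd_diag_weight:
  assumes "m \<ge> 1" "Poly_Mapping.keys z \<subseteq> cyc_tuples m 2" "YB_boundary m 2 z = 0"
  shows "int m dvd diag_weight m z"
  using diag_weight_cong_cycle_defect [OF assms(1,2)] cycle_defect_eq_0 [OF assms] by simp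

text \<open>Each pair lies on exactly one diagonal \<open>j\<close> and has weight
  \<open>j + 1\<close>.\<close>

lemma diag_weight_eq:
  assumes m: "m \<ge> 1" and z: "Poly_Mapping.keys z \<subseteq> cyc_tuples m 2"
  shows "diag_weight m z = (\<Sum>j\<in>cyc m. (j + 1) * diag_sum m j z)"
  using z
proof (induction rule: chain2_induct)
  case (pair a b)
  then show ?case
    using m by (simp add: diag_weight_def diag_sum_def of_bool_def mod_simps
        if_distrib [of "\<lambda>x. _ * x"] sum.delta cong: if_cong)
qed (simp_all add: diag_weight_def diag_sum_def pair_pairing_linear sum_subtractf
    right_diff_distrib)

section \<open>Boundaries\<close>

definition YB_boundaries2 :: "nat \<Rightarrow> (int list \<Rightarrow>\<^sub>0 int) set" where
  "YB_boundaries2 m = YB_boundary m 3 ` carrier (YB_chain_group m 3)"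

lemma zero_in_boundaries2: "0 \<in> YB_boundaries2 m"
  unfolding YB_boundaries2_def
  by (rule image_eqI [where x = 0]) (simp_all add: carrier_YB_chain_group_iff)

lemma boundaries2_diff:
  assumes "z \<in> YB_boundaries2 m" "w \<in> YB_boundaries2 m"
  shows "z - w \<in> YB_boundaries2 m"
proof -
  obtain z' w' where *: "z' \<in> carrier (YB_chain_group m 3)" "w' \<in> carrier (YB_chain_group m 3)"
      "z = YB_boundary m 3 z'" "w = YB_boundary m 3 w'"
    using assms by (auto simp: YB_boundaries2_def)
  then have "z' - w' \<in> carrier (YB_chain_group m 3)"
    using keys_diff [of z' w'] by (auto simp: carrier_YB_chain_group_iff)
  with * show ?thesis
    by (auto simp: YB_boundaries2_def YB_boundary_diff intro!: image_eqI [where x = "z' - w'"])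
qed

lemma triple_in_boundaries2:
  assumes "m \<ge> 1"
  shows "diag_step m b c - diag_step m (a - 1) c + diag_step m (a - 1) (b - 1) \<in> YB_boundaries2 m"
  unfolding YB_boundaries2_def
  by (rule image_eqI [where x = "frag_of [a mod int m, b mod int m, c mod int m]"])
    (use assms in \<open>auto simp: boundary3_triple carrier_YB_chain_group_iff cyc_tuples_def\<close>)

lemma boundaries2_induct [consumes 1, case_names zero triple diff]:
  assumes "z \<in> YB_boundaries2 m"
    and "P 0"
    and triple: "\<And>a b c. P (diag_step m b c - diag_step m (a - 1) c + diag_step m (a - 1) (b - 1))"
    and diff: "\<And>z w. P z \<Longrightarrow> P w \<Longrightarrow> P (z - w)"
  shows "P z"
proof -
  obtain u where u: "Poly_Mapping.keys u \<subseteq> cyc_tuples m 3" and z: "z = YB_boundary m 3 u"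
    using assms(1) by (auto simp: YB_boundaries2_def carrier_YB_chain_group_iff)
  from u have "P (YB_boundary m 3 u)"
  proof (induction rule: frag_induction)
    case (one xs)
    then obtain a b c where "xs = [a, b, c]" "a \<in> cyc m" "b \<in> cyc m" "c \<in> cyc m"
      by (auto simp: cyc_tuples_def length_eq_3_iff)
    then show ?case
      using triple [of b c a] boundary3_triple [of m a b c] by (simp add: mod_cyc)
  qed (use assms in \<open>auto simp: YB_boundary_diff\<close>)
  with z show ?thesis by simp
qed

lemma keys_diag_step: "m \<ge> 1 \<Longrightarrow> Poly_Mapping.keys (diag_step m a b) \<subseteq> cyc_tuples m 2"
  unfolding diag_step_def by (intro keys_diff_subset keys_cyc_pair)

text \<open>Raising both entries by one leaves \<open>y - x\<close> unchanged modulo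
  \<open>m\<close>.\<close>

lemma diag_sum_step [simp]: "diag_sum m j (diag_step m a b) = 0"
  by (simp add: diag_sum_def diag_step_def pair_pairing_linear mod_simps)

lemma boundary2_step:
  "YB_boundary m 2 (diag_step m a b) =
     (cyc_point m a - cyc_point m (a - 1) - (cyc_point m (a + 1) - cyc_point m a)) -
     (cyc_point m (b + 1) - cyc_point m b - (cyc_point m (b + 2) - cyc_point m (b + 1)))"
  by (simp add: diag_step_def YB_boundary_diff boundary2_pair algebra_simps)

text \<open>With \<open>q a = 2(a) - (a-1) - (a+1)\<close>, the step from \<open>(a, b)\<close> has
  boundary \<open>q a - q (b+1)\<close>. The three steps bounding a triple then give
  \<open>q b - q (c+1) - q (a-1) + q (c+1) + q (a-1) - q b = 0\<close>.\<close>

lemma boundary2_boundaries2: "z \<in> YB_boundaries2 m \<Longrightarrow> YB_boundary m 2 z = 0"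
  by (induction rule: boundaries2_induct)
    (simp_all add: YB_boundary_diff YB_boundary_add boundary2_step algebra_simps)

lemma diag_sum_linear:
  "diag_sum m j (z + w) = diag_sum m j z + diag_sum m j w"
  "diag_sum m j (z - w) = diag_sum m j z - diag_sum m j w"
  "diag_sum m j (frag_cmul c z) = c * diag_sum m j z"
  "diag_sum m j (sum f I) = (\<Sum>i\<in>I. diag_sum m j (f i))"
  by (simp_all add: diag_sum_def pair_pairing_linear)

lemma diag_sum_boundaries2: "z \<in> YB_boundaries2 m \<Longrightarrow> diag_sum m j z = 0"
  by (induction rule: boundaries2_induct) (simp_all add: diag_sum_linear, simp add: diag_sum_def)

lemma keys_boundaries2:
  assumes "m \<ge> 1" "z \<in> YB_boundaries2 m"
  shows "Poly_Mapping.keys z \<subseteq> cyc_tuples m 2"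
  using assms(2)
proof (induction rule: boundaries2_induct)
  case (triple a b c)
  show ?case
    by (intro subset_trans [OF keys_add] Un_least keys_diff_subset keys_diag_step assms(1))
next
  case (diff z w)
  then show ?case by (intro keys_diff_subset)
qed simp

section \<open>Normal forms of 2-chains modulo boundaries\<close>

definition has_normal_form :: "nat \<Rightarrow> (int list \<Rightarrow>\<^sub>0 int) \<Rightarrow> bool" where
  "has_normal_form m z \<longleftrightarrow> (\<exists>g. (\<Sum>t\<in>cyc m. g t) = 0 \<and>
     z - (\<Sum>j\<in>cyc m. frag_cmul (diag_sum m j z) (cyc_pair m 0 j))
       - (\<Sum>t\<in>cyc m. frag_cmul (g t) (diag_step m 0 t)) \<in> YB_boundaries2 m)"

lemma has_normal_form_diff:
  assumes "has_normal_form m z" "has_normal_form m w"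
  shows "has_normal_form m (z - w)"
proof -
  obtain g h where gh: "(\<Sum>t\<in>cyc m. g t) = 0" "(\<Sum>t\<in>cyc m. h t) = 0"
     "z - (\<Sum>j\<in>cyc m. frag_cmul (diag_sum m j z) (cyc_pair m 0 j))
       - (\<Sum>t\<in>cyc m. frag_cmul (g t) (diag_step m 0 t)) \<in> YB_boundaries2 m"
     "w - (\<Sum>j\<in>cyc m. frag_cmul (diag_sum m j w) (cyc_pair m 0 j))
       - (\<Sum>t\<in>cyc m. frag_cmul (h t) (diag_step m 0 t)) \<in> YB_boundaries2 m"
    using assms by (auto simp: has_normal_form_def)
  show ?thesis
    unfolding has_normal_form_def
    by (rule exI [where x = "\<lambda>t. g t - h t"])
      (use gh(1,2) boundaries2_diff [OF gh(3,4)]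
       in \<open>simp add: sum_subtractf diag_sum_linear frag_cmul_diff_distrib algebra_simps\<close>)
qed

text \<open>The boundary of the triple \<open>(1, a, b)\<close> trades the step at
  \<open>(a, b)\<close> for the step at \<open>(0, b)\<close> minus the step at
  \<open>(0, a-1)\<close>. These opposite coefficients explain the zero sum required of
  \<open>g\<close>.\<close>

lemma has_normal_form_step:
  assumes m: "m \<ge> 1"
  shows "has_normal_form m (diag_step m a b)"
proof -
  define g where "g t = of_bool (t = b mod int m) - (of_bool (t = (a - 1) mod int m) :: int)" for t
  have mod_step: "diag_step m 0 (c mod int m) = diag_step m 0 c" for c
    unfolding diag_step_def by (intro arg_cong2 [where f = minus] cyc_pair_cong) (simp_all add: mod_simps)
  have "(\<Sum>t\<in>cyc m. g t) = 0"
    using m by (simp add: g_def sum_subtractf of_bool_def sum.delta)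
  moreover have "(\<Sum>t\<in>cyc m. frag_cmul (g t) (diag_step m 0 t)) = diag_step m 0 b - diag_step m 0 (a - 1)"
    using m by (simp add: g_def frag_cmul_diff_distrib sum_subtractf of_bool_def sum.delta mod_step
        if_distrib [of "\<lambda>x. frag_cmul x _"] cong: if_cong)
  moreover have "diag_step m a b - (diag_step m 0 b - diag_step m 0 (a - 1)) \<in> YB_boundaries2 m"
    using triple_in_boundaries2 [OF m, of a b 1] by (simp add: algebra_simps)
  ultimately show ?thesis
    by (auto simp: has_normal_form_def)
qed

text \<open>Walking back along the diagonal reaches first entry 0 after \<open>k\<close> steps, each
  of which has a normal form.\<close>

lemma has_normal_form_pair:
  assumes m: "m \<ge> 1"
  shows "has_normal_form m (cyc_pair m (int k) b)"
proof (induction k arbitrary: b)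
  case 0
  have "(\<Sum>j\<in>cyc m. frag_cmul (diag_sum m j (cyc_pair m 0 b)) (cyc_pair m 0 j))
      = cyc_pair m 0 (b mod int m)"
    using m by (simp add: diag_sum_def of_bool_def sum.delta mod_simps
        if_distrib [of "\<lambda>x. frag_cmul x _"] cong: if_cong)
  also have "\<dots> = cyc_pair m 0 b"
    by (simp add: cyc_pair_def)
  finally show ?case
    unfolding has_normal_form_def
    by (intro exI [where x = "\<lambda>_. 0"]) (simp add: zero_in_boundaries2)
next
  case (Suc k)
  have "cyc_pair m (int (Suc k)) b = cyc_pair m (int k) (b - 1) - diag_step m (int k) (b - 1)"
    by (simp add: diag_step_def ac_simps)
  then show ?case
    using has_normal_form_diff [OF Suc has_normal_form_step [OF m]] by simp
qed

lemma has_normal_form_chain: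
  assumes m: "m \<ge> 1" and "Poly_Mapping.keys z \<subseteq> cyc_tuples m 2"
  shows "has_normal_form m z"
  using assms(2)
proof (induction rule: chain2_induct)
  case zero
  show ?case
    using has_normal_form_diff [OF has_normal_form_step [OF m] has_normal_form_step [OF m], of 0 0 0 0]
    by simp
next
  case (pair a b)
  then show ?case
    using has_normal_form_pair [OF m, of "nat a" b] by (simp add: cyc_def)
qed (rule has_normal_form_diff)

text \<open>Without diagonal sums, the normal form leaves only the combination \<open>w\<close> of
  steps at \<open>(0, t)\<close>. As \<open>w\<close> is itself a cycle, its defects vanish; this
  makes \<open>g\<close> constant, hence zero since its sum is zero.\<close>

lemma cycle_in_boundaries2:
  assumes m: "m \<ge> 1" and z: "Poly_Mapping.keys z \<subseteq> cyc_tuples m 2"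
    and cycle: "YB_boundary m 2 z = 0" and diag: "\<And>j. j \<in> cyc m \<Longrightarrow> diag_sum m j z = 0"
  shows "z \<in> YB_boundaries2 m"
proof -
  obtain g where g: "(\<Sum>t\<in>cyc m. g t) = 0"
    and B: "z - (\<Sum>t\<in>cyc m. frag_cmul (g t) (diag_step m 0 t)) \<in> YB_boundaries2 m"
    using has_normal_form_chain [OF m z] diag by (auto simp: has_normal_form_def)
  define w where "w = (\<Sum>t\<in>cyc m. frag_cmul (g t) (diag_step m 0 t))"
  have w_cycle: "YB_boundary m 2 w = 0"
    using boundary2_boundaries2 [OF B] cycle by (simp add: YB_boundary_diff w_def)
  have w_keys: "Poly_Mapping.keys w \<subseteq> cyc_tuples m 2"
    using keys_diff_subset [OF z keys_boundaries2 [OF m B]] by (simp add: w_def)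
  have "g u = g ((u + 1) mod int m)" if u: "u \<in> cyc m" for u
  proof -
    \<comment> \<open>The second entries of \<open>(0, t)\<close> and \<open>(1, t+1)\<close> enter
      the defect at \<open>s\<close> when \<open>t = s - 1\<close> and \<open>t = s - 2\<close>;
      this choice of \<open>s\<close> therefore compares \<open>g\<close> at \<open>u + 1\<close>
      and \<open>u\<close>.\<close>
    define s where "s = (u + 2) mod int m"
    have s: "s \<in> cyc m" using m by (simp add: s_def)
    have 2: "(t + 2) mod int m = s \<longleftrightarrow> t = u" if "t \<in> cyc m" for t
      using mod_shift_iff [OF u, of t 2] that by (simp add: s_def mod_cyc)
    have s': "s = ((u + 1) mod int m + 1) mod int m"
      by (simp add: s_def mod_simps ac_simps)
    have 1: "(t + 1) mod int m = s \<longleftrightarrow> t = (u + 1) mod int m" if "t \<in> cyc m" for t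
      unfolding s' using mod_shift_iff [of "(u + 1) mod int m" m t 1] that m by (simp add: mod_cyc)
    have "0 = cycle_defect m s w"
      using cycle_defect_eq_0 [OF m w_keys w_cycle s] by simp
    also have "\<dots> = (\<Sum>t\<in>cyc m. g t * (of_bool (0 = s) - of_bool ((t + 1) mod int m = s)
        - (of_bool (1 mod int m = s) - of_bool ((t + 2) mod int m = s))))"
      by (simp add: w_def cycle_defect_def pair_pairing_linear diag_step_def mod_simps add.assoc)
    also have "\<dots> = (\<Sum>t\<in>cyc m. g t * (of_bool (0 = s) - of_bool (1 mod int m = s)))
        - (\<Sum>t\<in>cyc m. g t * of_bool ((t + 1) mod int m = s))
        + (\<Sum>t\<in>cyc m. g t * of_bool ((t + 2) mod int m = s))"
      by (simp add: sum_subtractf sum.distrib algebra_simps)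
    \<comment> \<open>The first entries 0 and 1 do not depend on \<open>t\<close>, so their
      contribution is a multiple of the sum of \<open>g\<close>.\<close>
    also have "(\<Sum>t\<in>cyc m. g t * (of_bool (0 = s) - of_bool (1 mod int m = s))) = 0"
      by (simp add: g flip: sum_distrib_right)
    also have "(\<Sum>t\<in>cyc m. g t * of_bool ((t + 1) mod int m = s)) = g ((u + 1) mod int m)"
      using m by (simp add: 1 of_bool_def if_distrib [of "\<lambda>x. _ * x"] sum.delta cong: if_cong sum.cong)
    also have "(\<Sum>t\<in>cyc m. g t * of_bool ((t + 2) mod int m = s)) = g u"
      using u by (simp add: 2 of_bool_def if_distrib [of "\<lambda>x. _ * x"] sum.delta cong: if_cong sum.cong)
    finally show ?thesis by simp
  qed
  then have "g t = 0" if "t \<in> cyc m" for t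
    using cyclic_constant_sum_0 [of m g t] m g that by blast
  with B show ?thesis by simp
qed

section \<open>The homology group\<close>

definition YB_cycles2 :: "nat \<Rightarrow> (int list \<Rightarrow>\<^sub>0 int) set" where
  "YB_cycles2 m = {z. Poly_Mapping.keys z \<subseteq> cyc_tuples m 2 \<and> YB_boundary m 2 z = 0}"

text \<open>Diagonal 0 has weight 1, so the total weight and the other diagonal sums determine its
  sum. On cycles the division is exact. The restriction matches the extensional functions of
  \<open>product_group\<close>.\<close>

definition cycle_coords :: "nat \<Rightarrow> (int list \<Rightarrow>\<^sub>0 int) \<Rightarrow> nat \<Rightarrow> int" where
  "cycle_coords m z =
     (\<lambda>i\<in>{..<m}. if i = 0 then diag_weight m z div int m else diag_sum m (int i) z)"

text \<open>The cycles dual to \<open>cycle_coords\<close>: the full main diagonal, and each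
  \<open>(0, i)\<close> corrected by the \<open>i + 1\<close> diagonal pairs that cancel both its
  boundary and its weight.\<close>

definition basis_cycle :: "nat \<Rightarrow> nat \<Rightarrow> int list \<Rightarrow>\<^sub>0 int" where
  "basis_cycle m i =
     (if i = 0 then \<Sum>k<m. cyc_pair m (int k) (int k)
      else cyc_pair m 0 (int i) - (\<Sum>k<Suc i. cyc_pair m (int k) (int k)))"

text \<open>With \<open>h a = (a) - (a-1)\<close>, the boundaries \<open>h k - h (k+1)\<close>
  telescope to \<open>h 0 - h n\<close>.\<close>

lemma boundary2_diagonal:
  "YB_boundary m 2 (\<Sum>k<n. cyc_pair m (int k) (int k)) = YB_boundary m 2 (cyc_pair m 0 (int n - 1))"
  by (induction n) (simp_all add: YB_boundary_add boundary2_pair algebra_simps)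

lemma basis_cycle_in_cycles2:
  assumes m: "m \<ge> 1"
  shows "basis_cycle m i \<in> YB_cycles2 m"
proof -
  have diagonal: "Poly_Mapping.keys (\<Sum>k<n. cyc_pair m (int k) (int k)) \<subseteq> cyc_tuples m 2" for n
    by (intro keys_sum_subset keys_cyc_pair m)
  \<comment> \<open>The full diagonal closes up, because \<open>m\<close> and 0 are the same
    residue.\<close>
  have "YB_boundary m 2 (cyc_pair m 0 (int m - 1)) = 0"
  proof -
    have "cyc_point m (int m) = cyc_point m 0" "cyc_point m (int m - 1) = cyc_point m (- 1)"
      by (simp_all add: cyc_point_def mod_eq_dvd_iff)
    then show ?thesis by (simp add: boundary2_pair)
  qed
  moreover have "Poly_Mapping.keys (cyc_pair m 0 (int i) - (\<Sum>k<Suc i. cyc_pair m (int k) (int k)))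
      \<subseteq> cyc_tuples m 2"
    by (intro keys_diff_subset diagonal keys_cyc_pair m)
  ultimately show ?thesis
    using boundary2_diagonal [of m "Suc i"] boundary2_diagonal [of m m] diagonal [of m]
    by (simp add: YB_cycles2_def basis_cycle_def YB_boundary_diff del: sum.lessThan_Suc)
qed

lemma diag_weight_linear:
  "diag_weight m (z + w) = diag_weight m z + diag_weight m w"
  "diag_weight m (z - w) = diag_weight m z - diag_weight m w"
  "diag_weight m (frag_cmul c z) = c * diag_weight m z"
  "diag_weight m (sum f I) = (\<Sum>i\<in>I. diag_weight m (f i))"
  by (simp_all add: diag_weight_def pair_pairing_linear)

text \<open>Diagonal pairs have weight 1 and \<open>(0, i)\<close> has weight
  \<open>i + 1\<close>.\<close>

lemma diag_weight_basis_cycle: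
  assumes "i < m"
  shows "diag_weight m (basis_cycle m i) = (if i = 0 then int m else 0)"
proof -
  have "diag_weight m (\<Sum>k<n. cyc_pair m (int k) (int k)) = int n" for n
    by (simp add: diag_weight_linear, simp add: diag_weight_def mod_simps)
  moreover have "diag_weight m (cyc_pair m 0 (int i)) = int i + 1"
    using assms by (simp add: diag_weight_def)
  ultimately show ?thesis
    by (simp add: basis_cycle_def diag_weight_linear(2) del: sum.lessThan_Suc)
qed

lemma diag_sum_basis_cycle:
  assumes "i < m" "0 < j" "j < m"
  shows "diag_sum m (int j) (basis_cycle m i) = of_bool (i = j)"
proof -
  have "diag_sum m (int j) (\<Sum>k<n. cyc_pair m (int k) (int k)) = 0" for n
    using assms by (simp add: diag_sum_linear, simp add: diag_sum_def mod_simps)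
  moreover have "diag_sum m (int j) (cyc_pair m 0 (int i)) = of_bool (i = j)"
    using assms by (simp add: diag_sum_def)
  ultimately show ?thesis
    using assms by (simp add: basis_cycle_def diag_sum_linear(2) del: sum.lessThan_Suc)
qed

lemma keys_boundary2:
  assumes m: "m \<ge> 1" and z: "Poly_Mapping.keys z \<subseteq> cyc_tuples m 2"
  shows "Poly_Mapping.keys (YB_boundary m 2 z) \<subseteq> cyc_tuples m 1"
  using z
proof (induction rule: chain2_induct)
  case (pair a b)
  have points: "Poly_Mapping.keys (cyc_point m c) \<subseteq> cyc_tuples m 1" for c
    using m by (simp add: cyc_point_def cyc_tuples_def)
  show ?case
    unfolding boundary2_pair by (intro keys_diff_subset points)
next
  case (diff z w)
  then show ?case
    unfolding YB_boundary_diff by (intro keys_diff_subset)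
qed simp

section \<open>The cycle group and its coordinate homomorphism\<close>

lemma group_hom_boundary2:
  assumes "m \<ge> 1"
  shows "group_hom (YB_chain_group m 2) (YB_chain_group m 1) (YB_boundary m 2)"
  using keys_boundary2 [OF assms]
  by (auto simp: group_hom_def group_hom_axioms_def hom_def YB_chain_group_def YB_boundary_add)

lemma kernel_boundary2:
  "kernel (YB_chain_group m 2) (YB_chain_group m (2 - 1)) (YB_boundary m 2) = YB_cycles2 m"
  by (auto simp: kernel_def YB_cycles2_def YB_chain_group_def)

lemma carrier_YB_cycle_group2:
  assumes "m \<ge> 1"
  shows "carrier (YB_cycle_group m 2) = YB_cycles2 m"
proof -
  have "subgroup (YB_cycles2 m) (YB_chain_group m 2)"
    using group_hom.subgroup_kernel [OF group_hom_boundary2 [OF assms]] kernel_boundary2 [of m]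
    by simp
  then show ?thesis
    unfolding YB_cycle_group_def kernel_boundary2
    by (rule subgroup.carrier_subgroup_generated_subgroup)
qed

lemma group_YB_cycle_group: "group (YB_cycle_group m n)"
  by (simp add: YB_cycle_group_def YB_chain_group_def group.group_subgroup_generated)

lemma mult_YB_cycle_group: "z \<otimes>\<^bsub>YB_cycle_group m n\<^esub> w = z + w"
  by (simp add: YB_cycle_group_def YB_chain_group_def)

text \<open>Integer division by \<open>m\<close> is additive here because cycles have weight
  divisible by \<open>m\<close>.\<close>

lemma cycle_coords_hom:
  assumes m: "m \<ge> 1"
  shows "cycle_coords m \<in> hom (YB_cycle_group m 2) (product_group {..<m} (\<lambda>_. integer_group))"
proof (rule homI)
  fix z w
  assume "z \<in> carrier (YB_cycle_group m 2)" "w \<in> carrier (YB_cycle_group m 2)"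
  then have "int m dvd diag_weight m z"
    using cycle_dvd_diag_weight [OF m] by (simp add: carrier_YB_cycle_group2 [OF m] YB_cycles2_def)
  then show "cycle_coords m (z \<otimes>\<^bsub>YB_cycle_group m 2\<^esub> w) =
      cycle_coords m z \<otimes>\<^bsub>product_group {..<m} (\<lambda>_. integer_group)\<^esub> cycle_coords m w"
    by (auto simp: mult_YB_cycle_group cycle_coords_def diag_weight_linear diag_sum_linear
        div_plus_div_distrib_dvd_left)
qed (simp add: cycle_coords_def)

text \<open>The basis cycles have the unit vectors as coordinates, so the entries of
  \<open>v\<close> serve as coefficients of a preimage.\<close>

lemma cycle_coords_surj:
  assumes m: "m \<ge> 1"
  shows "cycle_coords m ` YB_cycles2 m = carrier (product_group {..<m} (\<lambda>_. integer_group))"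
proof (intro equalityI subsetI)
  fix v assume "v \<in> carrier (product_group {..<m} (\<lambda>_. integer_group))"
  then have v: "v \<in> extensional {..<m}"
    by (simp add: PiE_def)
  define z where "z = (\<Sum>i<m. frag_cmul (v i) (basis_cycle m i))"
  have "Poly_Mapping.keys (frag_cmul (v i) (basis_cycle m i)) \<subseteq> cyc_tuples m 2" for i
    using basis_cycle_in_cycles2 [OF m, of i] keys_cmul [of "v i" "basis_cycle m i"]
    by (auto simp: YB_cycles2_def)
  then have "Poly_Mapping.keys z \<subseteq> cyc_tuples m 2"
    unfolding z_def by (intro keys_sum_subset)
  moreover have "YB_boundary m 2 z = 0"
    using basis_cycle_in_cycles2 [OF m]
    by (simp add: z_def YB_boundary_sum YB_boundary_cmul YB_cycles2_def)
  moreover have "diag_weight m z = v 0 * int m"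
  proof -
    have "diag_weight m z = (\<Sum>i<m. if i = 0 then v i * int m else 0)"
      unfolding z_def diag_weight_linear by (intro sum.cong) (auto simp: diag_weight_basis_cycle)
    then show ?thesis using m by simp
  qed
  moreover have "diag_sum m (int j) z = v j" if "0 < j" "j < m" for j
  proof -
    have "diag_sum m (int j) z = (\<Sum>i<m. if i = j then v i else 0)"
      unfolding z_def diag_sum_linear using that
      by (intro sum.cong) (auto simp: diag_sum_basis_cycle)
    then show ?thesis using that by simp
  qed
  ultimately have "z \<in> YB_cycles2 m" and "cycle_coords m z i = v i" for i
    using m v by (auto simp: YB_cycles2_def cycle_coords_def extensional_def)
  then have "z \<in> YB_cycles2 m" and "cycle_coords m z = v"
    by auto
  then show "v \<in> cycle_coords m ` YB_cycles2 m" by blast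
qed (auto simp: cycle_coords_def)

lemma boundaries2_subset_cycles2: "m \<ge> 1 \<Longrightarrow> YB_boundaries2 m \<subseteq> YB_cycles2 m"
  using keys_boundaries2 boundary2_boundaries2 by (auto simp: YB_cycles2_def)

lemma cycle_coords_eq_0_iff:
  assumes m: "m \<ge> 1" and z: "z \<in> YB_cycles2 m"
  shows "cycle_coords m z = (\<lambda>i\<in>{..<m}. 0) \<longleftrightarrow> z \<in> YB_boundaries2 m"
proof
  have z': "Poly_Mapping.keys z \<subseteq> cyc_tuples m 2" "YB_boundary m 2 z = 0"
    using z by (auto simp: YB_cycles2_def)
  assume 0: "cycle_coords m z = (\<lambda>i\<in>{..<m}. 0)"
  have coord: "cycle_coords m z i = 0" if "i < m" for i
    using that by (simp add: 0)
  have "diag_weight m z div int m = 0"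
    using coord [of 0] m by (simp add: cycle_coords_def)
  then have weight: "diag_weight m z = 0"
    using cycle_dvd_diag_weight [OF m z'] by (metis dvd_div_eq_0_iff)
  have diag: "diag_sum m j z = 0" if "j \<in> cyc m" "j \<noteq> 0" for j
    using coord [of "nat j"] that by (auto simp: cycle_coords_def cyc_def)
  have "0 \<in> cyc m"
    using m by (simp add: cyc_def)
  \<comment> \<open>Diagonal 0 enters with coefficient 1, so its sum vanishes once the weight and
    all other diagonal sums do.\<close>
  then have "diag_weight m z = diag_sum m 0 z + (\<Sum>j\<in>cyc m - {0}. (j + 1) * diag_sum m j z)"
    by (simp add: diag_weight_eq [OF m z'(1)] sum.remove)
  then have "diag_sum m 0 z = 0"
    using weight diag by simp
  then show "z \<in> YB_boundaries2 m"
    using diag by (intro cycle_in_boundaries2 [OF m z']) blast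
next
  assume z: "z \<in> YB_boundaries2 m"
  then have "diag_weight m z = 0"
    using diag_weight_eq [OF m keys_boundaries2 [OF m z]] by (simp add: diag_sum_boundaries2)
  then show "cycle_coords m z = (\<lambda>i\<in>{..<m}. 0)"
    using z by (auto simp: cycle_coords_def diag_sum_boundaries2)
qed

section \<open>Torsion-freeness and the isomorphism theorem\<close>

lemma torsion_free_group_iso:
  assumes "group G" "group H" "G \<cong> H" "torsion_free_group H"
  shows "torsion_free_group G"
  unfolding torsion_free_group_def
proof (intro ballI allI impI)
  fix x and k :: nat
  assume x: "x \<in> carrier G" and k: "0 < k" "x [^]\<^bsub>G\<^esub> k = \<one>\<^bsub>G\<^esub>"
  obtain h where h: "h \<in> iso G H"
    using assms(3) by (auto simp: is_iso_def)
  then interpret group_hom G H h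
    using assms(1,2) by (simp add: group_hom_def group_hom_axioms_def iso_def)
  have "h x [^]\<^bsub>H\<^esub> k = \<one>\<^bsub>H\<^esub>"
    using x k hom_nat_pow [of x k] by simp
  then have "h x = h \<one>\<^bsub>G\<^esub>"
    using assms(4) x k by (simp add: torsion_free_group_def)
  moreover have "inj_on h (carrier G)"
    using h by (simp add: iso_def bij_betw_def)
  ultimately show "x = \<one>\<^bsub>G\<^esub>"
    using x by (metis inj_onD G.one_closed)
qed

lemma torsion_free_product_integer_group:
  "torsion_free_group (product_group I (\<lambda>_. integer_group))"
  unfolding torsion_free_group_def
proof (intro ballI allI impI)
  let ?P = "product_group I (\<lambda>_. integer_group)"
  fix x and k :: nat
  assume x: "x \<in> carrier ?P" and k: "0 < k" "x [^]\<^bsub>?P\<^esub> k = \<one>\<^bsub>?P\<^esub>"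
  have pow: "(x [^]\<^bsub>?P\<^esub> n) i = int n * x i" if "i \<in> I" for i n
    using that by (induction n) (simp_all add: algebra_simps)
  have "x i = 0" if "i \<in> I" for i
    using pow [OF that, of k] that k by simp
  then show "x = \<one>\<^bsub>?P\<^esub>"
    using x by (auto simp: PiE_def intro: extensionalityI)
qed

theorem theorem3p12:
  fixes m :: nat
  assumes "m \<ge> 1"
  shows "torsion_free_group (YB_homology_group m 2) \<and>
         YB_homology_group m 2 \<cong> product_group {..<m} (\<lambda>_. integer_group)"
proof -
  let ?Z = "YB_cycle_group m 2" and ?P = "product_group {..<m} (\<lambda>_. integer_group)"
  interpret coords: group_hom ?Z ?P "cycle_coords m"
    using cycle_coords_hom [OF assms]
    by (simp add: group_hom_def group_hom_axioms_def group_YB_cycle_group)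
  \<comment> \<open>Once the kernel of the surjective coordinate map is the group of boundaries, the
    first isomorphism theorem applies to the homology group.\<close>
  have "kernel ?Z ?P (cycle_coords m) = YB_boundaries2 m"
    using cycle_coords_eq_0_iff [OF assms] boundaries2_subset_cycles2 [OF assms]
    by (auto simp: kernel_def carrier_YB_cycle_group2 [OF assms])
  then have homology: "YB_homology_group m 2 = ?Z Mod kernel ?Z ?P (cycle_coords m)"
    by (simp add: YB_homology_group_def YB_boundaries2_def)
  have iso: "YB_homology_group m 2 \<cong> ?P"
    unfolding homology
    by (rule coords.FactGroup_iso) (simp only: carrier_YB_cycle_group2 [OF assms] cycle_coords_surj [OF assms])
  moreover have "group (YB_homology_group m 2)"
    unfolding homology by (intro normal.factorgroup_is_group coords.normal_kernel)
  ultimately show ?thesis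
    using torsion_free_group_iso [OF _ coords.H.is_group _ torsion_free_product_integer_group] by blast
qed

end
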